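(* Let $\alpha, x \in \mathbb{R}$ and let $n \ge 0$ be an integer. The higher-order Bernoulli polynomial $B_n^{(\alpha)}(x)$ satisfies $$B_{n}^{(\alpha)}(x)=\sum_{k=0}^{n}\binom{n}{k}\sum_{i=0}^{k}\langle -\alpha\rangle_{i}\,\frac{k!}{(k+i)!}\sum_{j=0}^{i}(-1)^{i-j}\binom{k+i}{i-j}S(k+j,j)\,x^{n-k}.$$ In particular, for $x=0$, the higher-order Bernoulli numbers $B_n^{(\alpha)} = B_n^{(\alpha)}(0)$ satisfy $$B_{n}^{(\alpha)}=\sum_{i=0}^{n}\langle -\alpha\rangle_{i}\,\frac{n!}{(n+i)!}\sum_{j=0}^{i}(-1)^{i-j}\binom{n+i}{i-j}S(n+j,j).$$
   Context: The higher-order Bernoulli polynomials $B_n^{(\alpha)}(x)$ are defined by the generating function $$\left(\frac{t}{e^{t}-1}\right)^{\alpha}e^{xt}=\sum_{n=0}^{\infty}B_n^{(\alpha)}(x)\frac{t^n}{n!}$$ for $t$ near $0$, where $t/(e^t-1)$ is taken to be $1$ at $t=0$ and the power is the branch equal to $1$ at $t=0$. The falling factorial is $\langle y\rangle_0=1$ and $\langle y\rangle_m=y(y-1)\cdots(y-m+1)$ for $m\ge1$, $y\in\mathbb{R}$. $S(n,k)$ denotes the Stirling numbers of the second kind, defined by $\frac{(e^t-1)^k}{k!}=\sum_{n=k}^{\infty}S(n,k)\frac{t^n}{n!}$ (so $S(0,0)=1$ and $S(n,0)=0$ for $n\ge1$). The convention $x^0=1$ (also for $x=0$) is used. *)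

theory Defs
  imports "HOL-Complex_Analysis.Complex_Analysis" "HOL-Combinatorics.Stirling"
begin

definition falling_fact :: "real \<Rightarrow> nat \<Rightarrow> real" where
  "falling_fact y m = (\<Prod>i<m. y - real i)"

lemma falling_fact_0 [simp]: "falling_fact y 0 = 1"
  by (simp add: falling_fact_def)

lemma falling_fact_Suc: "falling_fact y (Suc m) = falling_fact y m * (y - real m)"
  by (simp add: falling_fact_def)

text \<open>
  \<^const>\<open>powr\<close> on the complex numbers is the principal branch. The base is analytic at 0 with
  value 1 there, so for t near 0 this is the branch of the power that equals 1 at t = 0.
\<close>

definition bernoulli_gf :: "real \<Rightarrow> real \<Rightarrow> complex \<Rightarrow> complex" where
  "bernoulli_gf \<alpha> x t =
     (if t = 0 then 1 else t / (exp t - 1)) powr complex_of_real \<alpha> * exp (complex_of_real x * t)"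

text \<open>
  The number with index n in the only real sequence whose exponential generating function
  converges to \<^const>\<open>bernoulli_gf\<close> near 0; \<open>higher_bernoulli_ex1\<close> below shows that it is
  well defined.
\<close>

definition higher_bernoulli :: "real \<Rightarrow> nat \<Rightarrow> real \<Rightarrow> real" where
  "higher_bernoulli \<alpha> n x =
     (THE B :: nat \<Rightarrow> real. \<forall>\<^sub>F t in nhds (0::complex).
        (\<lambda>m. complex_of_real (B m) * (t ^ m / fact m)) sums bernoulli_gf \<alpha> x t) n"

lemma sums_imp_has_fps_expansion:
  fixes a :: "nat \<Rightarrow> complex"
  assumes "\<forall>\<^sub>F t in nhds 0. (\<lambda>n. a n * t ^ n) sums f t"
  shows "f has_fps_expansion Abs_fps a"
proof -
  from assms obtain d where d: "d > 0" "\<And>t. dist t 0 < d \<Longrightarrow> (\<lambda>n. a n * t ^ n) sums f t"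
    unfolding eventually_nhds_metric by blast
  have "summable (\<lambda>n. a n * complex_of_real (d/2) ^ n)"
    using d(1) by (intro sums_summable[OF d(2)]) auto
  then have "conv_radius a \<ge> norm (complex_of_real (d/2))"
    by (rule conv_radius_geI)
  then have "fps_conv_radius (Abs_fps a) \<ge> ereal (d/2)"
    using d(1) by (simp add: fps_conv_radius_def)
  then have "fps_conv_radius (Abs_fps a) > 0"
    using d(1) by (metis ereal_less(2) half_gt_zero less_le_trans)
  moreover have "\<forall>\<^sub>F t in nhds 0. eval_fps (Abs_fps a) t = f t"
    using assms by eventually_elim (auto simp: eval_fps_def sums_iff)
  ultimately show ?thesis
    by (simp add: has_fps_expansion_def)
qed

lemma has_fps_expansion_imp_sums:
  assumes "f has_fps_expansion F"
  shows "\<forall>\<^sub>F t in nhds 0. (\<lambda>n. fps_nth F n * t ^ n) sums f t"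
proof -
  have "\<forall>\<^sub>F t in nhds 0. t \<in> eball 0 (fps_conv_radius F)"
    using assms by (intro eventually_nhds_in_open) (auto simp: has_fps_expansion_def zero_ereal_def)
  moreover have "\<forall>\<^sub>F t in nhds 0. eval_fps F t = f t"
    using assms by (simp add: has_fps_expansion_def)
  ultimately show ?thesis
  proof eventually_elim
    case (elim t)
    then show ?case
      using sums_eval_fps[of t F] by (simp add: in_eball_iff)
  qed
qed

lemma bernoulli_base_analytic:
  "(\<lambda>t::complex. if t = 0 then 1 else t / (exp t - 1)) analytic_on {0}"
proof -
  have sub: "subdegree (1 - fps_exp (1::complex)) = 1"
    by (rule subdegreeI) auto
  have "(\<lambda>t::complex. if t = 0 then 1 else t / (exp t - 1)) has_fps_expansion
          (fps_X / (fps_exp 1 - 1))"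
    by (rule has_fps_expansion_divide)
       (use sub in \<open>auto intro: fps_expansion_intros\<close>)
  then show ?thesis
    by (rule has_fps_expansion_imp_analytic_0)
qed

lemma bernoulli_gf_analytic: "bernoulli_gf \<alpha> x analytic_on {0}"
  unfolding bernoulli_gf_def
  by (intro analytic_intros bernoulli_base_analytic) auto

lemma bernoulli_gf_cnj: "\<forall>\<^sub>F t in nhds 0. cnj (bernoulli_gf \<alpha> x (cnj t)) = bernoulli_gf \<alpha> x t"
proof -
  define g where "g = (\<lambda>t::complex. if t = 0 then 1 else t / (exp t - 1))"
  have gf: "bernoulli_gf \<alpha> x t = g t powr complex_of_real \<alpha> * exp (complex_of_real x * t)" for t
    by (simp add: bernoulli_gf_def g_def)
  have g_cnj: "g (cnj t) = cnj (g t)" for t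
    by (simp add: g_def exp_cnj)
  have "isCont g 0"
    using bernoulli_base_analytic unfolding g_def by (rule analytic_at_imp_isCont)
  then have "(g \<longlongrightarrow> g 0) (nhds 0)"
    by (simp add: isCont_def tendsto_nhds_iff)
  then have "\<forall>\<^sub>F t in nhds 0. g t \<in> {z. Re z > 0}"
    by (rule topological_tendstoD) (auto simp: open_halfspace_Re_gt g_def)
  then show ?thesis
  proof eventually_elim
    case (elim t)
    then have "cnj (g t powr complex_of_real \<alpha>) = cnj (g t) powr complex_of_real \<alpha>"
      by (subst cnj_powr) (auto simp: complex_nonpos_Reals_iff)
    moreover have "exp (complex_of_real x * cnj t) = cnj (exp (complex_of_real x * t))"
      by (simp add: exp_cnj)
    ultimately have "bernoulli_gf \<alpha> x (cnj t) = cnj (bernoulli_gf \<alpha> x t)"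
      by (simp add: gf g_cnj)
    then show ?case
      by simp
  qed
qed

lemma higher_bernoulli_ex1:
  "\<exists>!B :: nat \<Rightarrow> real. \<forall>\<^sub>F t in nhds (0::complex).
      (\<lambda>m. complex_of_real (B m) * (t ^ m / fact m)) sums bernoulli_gf \<alpha> x t"
proof -
  define F where "F = fps_expansion (bernoulli_gf \<alpha> x) 0"
  have F: "bernoulli_gf \<alpha> x has_fps_expansion F"
    unfolding F_def by (rule analytic_at_imp_has_fps_expansion_0[OF bernoulli_gf_analytic])
  have sumsF: "\<forall>\<^sub>F t in nhds 0. (\<lambda>n. fps_nth F n * t ^ n) sums bernoulli_gf \<alpha> x t"
    by (rule has_fps_expansion_imp_sums[OF F])
  have "filterlim cnj (nhds 0) (nhds 0)"
    using tendsto_cnj[OF filterlim_ident[of "nhds 0"]] by simp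
  from eventually_compose_filterlim[OF sumsF this]
  have "\<forall>\<^sub>F t in nhds 0. (\<lambda>n. cnj (fps_nth F n) * t ^ n) sums bernoulli_gf \<alpha> x t"
    using bernoulli_gf_cnj[of \<alpha> x]
  proof eventually_elim
    case (elim t)
    from elim(1) have "(\<lambda>n. cnj (fps_nth F n * cnj t ^ n)) sums cnj (bernoulli_gf \<alpha> x (cnj t))"
      by (simp only: sums_cnj)
    then show ?case
      using elim(2) by simp
  qed
  then have "Abs_fps (\<lambda>n. cnj (fps_nth F n)) = F"
    by (intro fps_expansion_unique_complex[OF sums_imp_has_fps_expansion F])
  then have "cnj (fps_nth F n) = fps_nth F n" for n
    by (metis fps_nth_Abs_fps)
  then have real: "complex_of_real (Re (fps_nth F n)) = fps_nth F n" for n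
    by (metis Reals_cnj_iff of_real_Re)
  show ?thesis
  proof (rule ex1I[of _ "\<lambda>n. Re (fps_nth F n) * fact n"])
    show "\<forall>\<^sub>F t in nhds (0::complex).
        (\<lambda>m. complex_of_real (Re (fps_nth F m) * fact m) * (t ^ m / fact m))
          sums bernoulli_gf \<alpha> x t"
      using sumsF by (simp add: real)
  next
    fix B :: "nat \<Rightarrow> real"
    assume "\<forall>\<^sub>F t in nhds (0::complex).
        (\<lambda>m. complex_of_real (B m) * (t ^ m / fact m)) sums bernoulli_gf \<alpha> x t"
    then have "\<forall>\<^sub>F t in nhds (0::complex).
        (\<lambda>m. (complex_of_real (B m) / fact m) * t ^ m) sums bernoulli_gf \<alpha> x t"
      by simp
    then have eq: "Abs_fps (\<lambda>m. complex_of_real (B m) / fact m) = F"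
      by (intro fps_expansion_unique_complex[OF sums_imp_has_fps_expansion F])
    have "complex_of_real (B m) = complex_of_real (Re (fps_nth F m) * fact m)" for m
      using real[of m] by (simp flip: eq add: field_simps)
    then show "B = (\<lambda>m. Re (fps_nth F m) * fact m)"
      by (intro ext) (simp only: of_real_eq_iff)
  qed
qed

lemma higher_bernoulli_sums:
  "\<forall>\<^sub>F t in nhds (0::complex).
     (\<lambda>n. complex_of_real (higher_bernoulli \<alpha> n x) * (t ^ n / fact n)) sums bernoulli_gf \<alpha> x t"
  unfolding higher_bernoulli_def by (rule theI'[OF higher_bernoulli_ex1])

text \<open>
  \<^const>\<open>Stirling\<close> is defined by its recurrence; the next lemma is the definition of the numbers
  by the exponential generating function.
\<close>

lemma Stirling_egf:
  "(fps_exp (1::real) - 1) ^ k = fps_const (fact k) * Abs_fps (\<lambda>n. real (Stirling n k) / fact n)"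
proof (induction k)
  case 0
  have "Stirling n 0 = (if n = 0 then 1 else 0)" for n
    by (cases n) auto
  then show ?case
    by (auto simp: fps_eq_iff)
next
  case (Suc k)
  let ?P = "(fps_exp (1::real) - 1) ^ k" and ?G = "(fps_exp (1::real) - 1) ^ Suc k"
  have deriv: "fps_deriv ?G = fps_const (real (Suc k)) * (?G + ?P)"
    unfolding fps_deriv_power by (simp add: algebra_simps flip: fps_of_nat)
  have rec: "real (Suc n) * fps_nth ?G (Suc n) = real (Suc k) * (fps_nth ?G n + fps_nth ?P n)" for n
    using arg_cong[OF deriv, of "\<lambda>f. fps_nth f n"]
    by (simp del: power_Suc of_nat_Suc)
  have "fps_nth ?G n = fact (Suc k) * real (Stirling n (Suc k)) / fact n" for n
  proof (induction n)
    case 0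
    then show ?case by simp
  next
    case (Suc n)
    have P: "fps_nth ?P n = fact k * real (Stirling n k) / fact n"
      by (simp add: Suc.IH \<open>?P = _\<close>)
    have "real (Suc n) * fps_nth ?G (Suc n) = fact (Suc k) * real (Stirling (Suc n) (Suc k)) / fact n"
      unfolding rec Suc.IH P by (simp add: field_simps)
    then have "fps_nth ?G (Suc n) = fact (Suc k) * real (Stirling (Suc n) (Suc k)) / fact n / real (Suc n)"
      by (metis nonzero_mult_div_cancel_left of_nat_neq_0)
    then show ?case
      by (simp only: fact_Suc[of n] divide_divide_eq_left of_nat_mult mult.commute)
  qed
  then show ?case
    by (simp add: fps_eq_iff del: power_Suc)
qed

end

theory Submission
  imports Defs
begin

text \<open>
  Near 0 the generating function is \<open>(1 + u) powr (-\<alpha>) * exp (x * t)\<close> with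
  \<open>u = (exp t - 1) / t - 1\<close>. As u vanishes at 0, the binomial series can be composed with the
  power series of u, and the expansion of \<open>u ^ i\<close> by the finite binomial theorem has the
  Stirling numbers in its coefficients, because \<open>(exp t - 1) ^ j / fact j\<close> is their exponential
  generating function.
\<close>

text \<open>Transfers coefficients of powers from real series to series over other algebras, so that
  the real identity \<open>Stirling_egf\<close> also serves over the complex numbers.\<close>

lemma fps_of_real_power:
  "Abs_fps (\<lambda>n. of_real (fps_nth f n)) ^ k =
     Abs_fps (\<lambda>n. of_real (fps_nth (f ^ k) n) :: 'a :: {real_algebra_1, comm_ring_1})"
proof (induction k)
  case 0
  show ?case by (auto simp: fps_eq_iff)
next
  case (Suc k)
  then show ?case by (simp add: fps_eq_iff fps_mult_nth)
qed

lemma fps_nth_exp_minus_one_power: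
  "fps_nth ((fps_exp 1 - 1) ^ k) n =
     (of_real (fact k * real (Stirling n k) / fact n) :: 'a :: real_field)"
proof -
  have "(fps_exp 1 - 1 :: 'a fps) = Abs_fps (\<lambda>n. of_real (fps_nth (fps_exp 1 - 1) n))"
    by (auto simp: fps_eq_iff)
  then have "(fps_exp 1 - 1 :: 'a fps) ^ k =
               Abs_fps (\<lambda>n. of_real (fps_nth ((fps_exp 1 - 1) ^ k) n))"
    by (simp only: fps_of_real_power)
  then show ?thesis
    by (simp add: Stirling_egf)
qed

text \<open>The series of (exp t - 1) / t, the reciprocal of the base in
  \<open>bernoulli_gf\<close>.\<close>

definition fps_exp_quotient :: "'a :: field_char_0 fps" where
  "fps_exp_quotient = fps_shift 1 (fps_exp 1 - 1)"

lemma fps_nth_exp_quotient_0 [simp]: "fps_nth fps_exp_quotient 0 = 1"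
  by (simp add: fps_exp_quotient_def)

text \<open>Multiplication by \<open>fps_X ^ j\<close> turns this power into
  \<open>(fps_exp 1 - 1) ^ j\<close> and moves index k to k + j.\<close>

lemma fps_nth_exp_quotient_power:
  "fps_nth (fps_exp_quotient ^ j) k =
     (of_real (fact j * real (Stirling (k + j) j) / fact (k + j)) :: 'a :: real_field)"
proof -
  have "fps_exp_quotient * fps_X = (fps_exp 1 - 1 :: 'a fps)"
    by (auto simp: fps_eq_iff fps_exp_quotient_def)
  then have "fps_exp_quotient ^ j * fps_X ^ j = (fps_exp 1 - 1 :: 'a fps) ^ j"
    by (simp flip: power_mult_distrib)
  then have "fps_nth ((fps_exp 1 - 1) ^ j) (k + j) = fps_nth (fps_exp_quotient ^ j :: 'a fps) k"
    by (metis add_diff_cancel_right' fps_X_power_mult_right_nth not_add_less2)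
  then show ?thesis
    by (simp add: fps_nth_exp_minus_one_power)
qed

lemma fps_nth_exp_quotient_minus_one_power:
  "fps_nth ((fps_exp_quotient - 1) ^ i) k =
     (of_real (fact i / fact (k + i) * (\<Sum>j=0..i. (-1) ^ (i - j) *
        real ((k + i) choose (i - j)) * real (Stirling (k + j) j)))
      :: 'a :: real_field)"
proof -
  have "fps_nth ((fps_exp_quotient - 1 :: 'a fps) ^ i) k =
          fps_nth (\<Sum>j\<le>i. fps_const (of_real (real (i choose j) * (-1) ^ (i - j))) *
            fps_exp_quotient ^ j) k"
    using binomial_ring[of "fps_exp_quotient :: 'a fps" "-1" i]
    by (simp add: fps_of_nat [symmetric] fps_const_neg [symmetric] mult.commute mult.left_commute
        flip: fps_const_mult fps_const_power)
  also have "\<dots> = of_real (\<Sum>j\<le>i. real (i choose j) * (-1) ^ (i - j) *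
                     (fact j * real (Stirling (k + j) j) / fact (k + j)))"
    by (simp add: fps_sum_nth fps_nth_exp_quotient_power)
  \<comment> \<open>Termwise, both (i choose j) * j! / (k+j)! and i! / (k+i)! * (k+i choose i-j)
    equal i! / ((i-j)! (k+j)!).\<close>
  also have "(\<Sum>j\<le>i. real (i choose j) * (-1) ^ (i - j) *
                (fact j * real (Stirling (k + j) j) / fact (k + j))) =
             fact i / fact (k + i) * (\<Sum>j=0..i. (-1) ^ (i - j) *
                real ((k + i) choose (i - j)) * real (Stirling (k + j) j))"
    unfolding sum_distrib_left atLeast0AtMost
    by (intro sum.cong refl) (simp add: binomial_fact field_simps)
  finally show ?thesis .
qed

lemma bernoulli_gf_has_fps_expansion:
  "bernoulli_gf \<alpha> x has_fps_expansion
     (fps_binomial (complex_of_real (-\<alpha>)) oo (fps_exp_quotient - 1)) * fps_exp (complex_of_real x)"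
proof -
  \<comment> \<open>The form \<open>t ^ 1\<close> matches \<open>has_fps_expansion_shift\<close>;
    the value 1 at 0 is the coefficient of \<open>fps_exp 1 - 1\<close> at index 1.\<close>
  define w :: "complex \<Rightarrow> complex" where "w = (\<lambda>t. if t = 0 then 1 else (exp t - 1) / t ^ 1)"
  have "(\<lambda>t::complex. exp t - 1) has_fps_expansion (fps_exp 1 - 1)"
    by (intro fps_expansion_intros)
  moreover have "1 \<le> subdegree (fps_exp (1 :: complex) - 1)"
    by (rule subdegree_geI) (auto simp: fps_eq_iff intro!: exI[of _ 1])
  ultimately have w: "w has_fps_expansion fps_exp_quotient"
    unfolding w_def fps_exp_quotient_def by (rule has_fps_expansion_shift) simp
  have "((\<lambda>z. (1 + z) powr complex_of_real (-\<alpha>)) \<circ> (\<lambda>t. w t - 1)) has_fps_expansion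
          (fps_binomial (complex_of_real (-\<alpha>)) oo (fps_exp_quotient - 1))"
    by (intro has_fps_expansion_compose fps_expansion_intros w) auto
  then have exp: "(\<lambda>t. ((\<lambda>z. (1 + z) powr complex_of_real (-\<alpha>)) \<circ> (\<lambda>t. w t - 1)) t *
                exp (complex_of_real x * t)) has_fps_expansion
          (fps_binomial (complex_of_real (-\<alpha>)) oo (fps_exp_quotient - 1)) *
            fps_exp (complex_of_real x)"
    by (intro has_fps_expansion_mult has_fps_expansion_exp)
  \<comment> \<open>By continuity \<open>w t\<close> stays in the right half-plane near 0, off the
    branch cut of \<open>Ln\<close>. There \<open>Ln\<close> of the inverse is the negated
    \<open>Ln\<close>, so exponent \<alpha> on the base becomes exponent -\<alpha> on
    \<open>w t\<close>.\<close>
  have "isCont w 0"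
    using w has_fps_expansion_imp_analytic_0 analytic_at_imp_isCont by blast
  then have "(w \<longlongrightarrow> w 0) (nhds 0)"
    by (simp add: isCont_def tendsto_nhds_iff)
  then have "\<forall>\<^sub>F t in nhds 0. w t \<in> {z. Re z > 0}"
    by (rule topological_tendstoD) (auto simp: open_halfspace_Re_gt w_def)
  then have "\<forall>\<^sub>F t in nhds 0. ((\<lambda>z. (1 + z) powr complex_of_real (-\<alpha>)) \<circ> (\<lambda>t. w t - 1)) t *
                exp (complex_of_real x * t) = bernoulli_gf \<alpha> x t"
  proof eventually_elim
    case (elim t)
    then have "w t \<notin> \<real>\<^sub>\<le>\<^sub>0" "w t \<noteq> 0"
      by (auto simp: complex_nonpos_Reals_iff)
    then have "inverse (w t) powr complex_of_real \<alpha> = w t powr complex_of_real (-\<alpha>)"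
      by (simp add: powr_def Ln_inverse)
    moreover have "inverse (w t) = (if t = 0 then 1 else t / (exp t - 1))"
      by (simp add: w_def)
    ultimately show ?case
      by (simp add: bernoulli_gf_def)
  qed
  then show ?thesis
    by (rule has_fps_expansion_cong[OF _ refl, THEN iffD1, OF _ exp])
qed

text \<open>Two expansions of the same function at 0 coincide; \<open>fact n\<close> undoes the
  exponential normalisation.\<close>

lemma higher_bernoulli_eq_fps_nth:
  "complex_of_real (higher_bernoulli \<alpha> n x) = fact n *
     fps_nth ((fps_binomial (complex_of_real (-\<alpha>)) oo (fps_exp_quotient - 1)) *
       fps_exp (complex_of_real x)) n"
proof -
  have "\<forall>\<^sub>F t in nhds (0::complex).
     (\<lambda>m. (complex_of_real (higher_bernoulli \<alpha> m x) / fact m) * t ^ m) sums bernoulli_gf \<alpha> x t"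
    using higher_bernoulli_sums[of \<alpha> x] by simp
  from fps_expansion_unique_complex[OF sums_imp_has_fps_expansion[OF this]
      bernoulli_gf_has_fps_expansion, symmetric]
  show ?thesis
    by simp
qed

text \<open>The \<open>fact i\<close> here is the one in front of the coefficients of
  \<open>(fps_exp_quotient - 1) ^ i\<close>.\<close>

lemma fact_mult_gbinomial_of_real:
  "fact i * (complex_of_real y gchoose i) = complex_of_real (falling_fact y i)"
  by (simp add: gbinomial_prod_rev falling_fact_def atLeast0LessThan)

text \<open>The sum stops at i = k because \<open>(fps_exp_quotient - 1) ^ i\<close> has no terms of
  order below i.\<close>

lemma fps_nth_binomial_compose_exp_quotient:
  "fps_nth (fps_binomial (complex_of_real y) oo (fps_exp_quotient - 1)) k =
     complex_of_real (\<Sum>i=0..k. falling_fact y i * (1 / fact (k + i)) *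
       (\<Sum>j=0..i. (-1) ^ (i - j) * real ((k + i) choose (i - j)) * real (Stirling (k + j) j)))"
  unfolding fps_compose_nth fps_nth_exp_quotient_minus_one_power of_real_sum [of _ "{0..k}"]
  by (intro sum.cong refl) (simp flip: fact_mult_gbinomial_of_real)

lemma higher_bernoulli_explicit:
  "higher_bernoulli \<alpha> n x =
     (\<Sum>k=0..n. real (n choose k) *
        (\<Sum>i=0..k. falling_fact (-\<alpha>) i * (fact k / fact (k + i)) *
           (\<Sum>j=0..i. (-1) ^ (i - j) * real ((k + i) choose (i - j)) *
              real (Stirling (k + j) j))) * x ^ (n - k))"
proof -
  \<comment> \<open>These are the coefficients of the composed binomial series; the Cauchy product
    with the series of exp (x t) then gives the outer sum.\<close>
  define c where "c k = (\<Sum>i=0..k. falling_fact (-\<alpha>) i * (1 / fact (k + i)) *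
           (\<Sum>j=0..i. (-1) ^ (i - j) * real ((k + i) choose (i - j)) *
              real (Stirling (k + j) j)))" for k
  have c: "fact k * c k = (\<Sum>i=0..k. falling_fact (-\<alpha>) i * (fact k / fact (k + i)) *
           (\<Sum>j=0..i. (-1) ^ (i - j) * real ((k + i) choose (i - j)) *
              real (Stirling (k + j) j)))" for k
    unfolding c_def sum_distrib_left[of "fact k"] by (intro sum.cong refl) simp
  have "complex_of_real (higher_bernoulli \<alpha> n x) =
          complex_of_real (\<Sum>k=0..n. fact n * (c k * (x ^ (n - k) / fact (n - k))))"
    unfolding higher_bernoulli_eq_fps_nth fps_mult_nth fps_nth_binomial_compose_exp_quotient
      c_def [symmetric]
    by (simp add: sum_distrib_left)
  then have "higher_bernoulli \<alpha> n x = (\<Sum>k=0..n. fact n * (c k * (x ^ (n - k) / fact (n - k))))"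
    by (simp only: of_real_eq_iff)
  \<comment> \<open>Uses n! / (n-k)! = (n choose k) * k!.\<close>
  also have "\<dots> = (\<Sum>k=0..n. real (n choose k) * (fact k * c k) * x ^ (n - k))"
    by (intro sum.cong refl) (simp add: binomial_fact)
  finally show ?thesis
    by (simp only: c)
qed

theorem theorem3p1:
  fixes \<alpha> x :: real and n :: nat
  shows "higher_bernoulli \<alpha> n x =
           (\<Sum>k=0..n. real (n choose k) *
              (\<Sum>i=0..k. falling_fact (-\<alpha>) i * (fact k / fact (k + i)) *
                 (\<Sum>j=0..i. (-1) ^ (i - j) * real ((k + i) choose (i - j)) *
                    real (Stirling (k + j) j))) * x ^ (n - k))
         \<and>
         higher_bernoulli \<alpha> n 0 =
           (\<Sum>i=0..n. falling_fact (-\<alpha>) i * (fact n / fact (n + i)) *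
              (\<Sum>j=0..i. (-1) ^ (i - j) * real ((n + i) choose (i - j)) *
                 real (Stirling (n + j) j)))"
proof -
  \<comment> \<open>At x = 0 only k = n survives, with \<open>0 ^ 0 = 1\<close>.\<close>
  have "(\<Sum>k=0..n. real (n choose k) * f k * 0 ^ (n - k)) = f n" for f :: "nat \<Rightarrow> real"
  proof -
    have "(\<Sum>k=0..n. real (n choose k) * f k * 0 ^ (n - k)) = (\<Sum>k=0..n. if k = n then f n else 0)"
      by (intro sum.cong refl) (auto simp: power_0_left)
    then show ?thesis
      by simp
  qed
  then show ?thesis
    using higher_bernoulli_explicit by simp
qed

end
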